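(* Let $A$ be an associative algebra, $M$ an $A$-bimodule, and $(T_1,T_2)$ a compatible $\mathcal{O}$-operator on $M$ over $A$. Then $(M,\star_1,\star_2)$ is a compatible associative algebra, where $$u\star_1 v = T_1(u)\cdot v+u\cdot T_1(v),\qquad u\star_2 v=T_2(u)\cdot v+u\cdot T_2(v),\qquad u,v\in M.$$ Moreover, $(A,l_{T_1},r_{T_1},l_{T_2},r_{T_2})$ is a compatible bimodule over the compatible associative algebra $(M,\star_1,\star_2)$, where for $i=1,2$, $l_{T_i}:M\otimes A\to A$ and $r_{T_i}:A\otimes M\to A$ are given by $$l_{T_i}(u,a)=T_i(u)\cdot a-T_i(u\cdot a),\qquad r_{T_i}(a,u)=a\cdot T_i(u)-T_i(a\cdot u).$$
   Context: All vector spaces are over a field $\mathbf{k}$ of characteristic $0$. Associative algebras are not assumed unital. For an associative algebra $A$ and an $A$-bimodule $M$, $\cdot$ denotes both the product of $A$ and the left and right actions on $M$. An $\mathcal{O}$-operator on $M$ over $A$ is a linear map $T:M\to A$ with $T(u)\cdot T(v)=T(T(u)\cdot v+u\cdot T(v))$ for all $u,v\in M$. A compatible $\mathcal{O}$-operator on $M$ over $A$ is a pair $(T_1,T_2)$ of $\mathcal{O}$-operators such that for all $u,v\in M$ $$T_1(u)\cdot T_2(v)+T_2(u)\cdot T_1(v)=T_1(T_2(u)\cdot v+u\cdot T_2(v))+T_2(T_1(u)\cdot v+u\cdot T_1(v)).$$ A compatible associative algebra is a triple $(B,\cdot_1,\cdot_2)$ such that $(B,\cdot_1)$ and $(B,\cdot_2)$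 are associative algebras and $(a\cdot_1 b)\cdot_2 c+(a\cdot_2 b)\cdot_1 c=a\cdot_2(b\cdot_1 c)+a\cdot_1(b\cdot_2 c)$ for all $a,b,c\in B$. A compatible bimodule over $(B,\cdot_1,\cdot_2)$ is a tuple $(N,l_1,r_1,l_2,r_2)$, with $N$ a vector space and $l_i:B\otimes N\to N$, $(a,u)\mapsto a\cdot_i u$, $r_i:N\otimes B\to N$, $(u,a)\mapsto u\cdot_i a$, such that $(N,l_i,r_i)$ is a bimodule over $(B,\cdot_i)$ for $i=1,2$, and for all $a,b\in B$, $u\in N$: $$(a\cdot_1 b)\cdot_2 u+(a\cdot_2 b)\cdot_1 u=a\cdot_1(b\cdot_2 u)+a\cdot_2(b\cdot_1 u),$$ $$(a\cdot_1 u)\cdot_2 b+(a\cdot_2 u)\cdot_1 b=a\cdot_1(u\cdot_2 b)+a\cdot_2(u\cdot_1 b),$$ $$(u\cdot_1 a)\cdot_2 b+(u\cdot_2 a)\cdot_1 b=u\cdot_1(a\cdot_2 b)+u\cdot_2(a\cdot_1 b).$$ *)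

theory Defs
  imports Complex_Main
begin

text \<open>
  Vector spaces are carried by whole types of class \<^class>\<open>ab_group_add\<close>, with an explicit scalar
  multiplication satisfying \<^locale>\<open>vector_space\<close>. A linear map out of \<open>U \<otimes> V\<close> is given as a
  bilinear map on \<open>U\<close> and \<open>V\<close>. Associative algebras need not have a unit, so the product is a
  parameter and not a type class operation.
\<close>

definition bilinear_map ::
  "('k::field \<Rightarrow> 'u::ab_group_add \<Rightarrow> 'u) \<Rightarrow> ('k \<Rightarrow> 'v::ab_group_add \<Rightarrow> 'v) \<Rightarrow>
   ('k \<Rightarrow> 'w::ab_group_add \<Rightarrow> 'w) \<Rightarrow> ('u \<Rightarrow> 'v \<Rightarrow> 'w) \<Rightarrow> bool"
  where "bilinear_map sU sV sW f \<longleftrightarrow>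
    (\<forall>u. Vector_Spaces.linear sV sW (\<lambda>v. f u v)) \<and>
    (\<forall>v. Vector_Spaces.linear sU sW (\<lambda>u. f u v))"

locale assoc_algebra = vector_space scale
  for scale :: "'k::field \<Rightarrow> 'b::ab_group_add \<Rightarrow> 'b" +
  fixes mult :: "'b \<Rightarrow> 'b \<Rightarrow> 'b"
  assumes mult_bilinear: "bilinear_map scale scale scale mult"
    and mult_assoc: "mult (mult a b) c = mult a (mult b c)"

locale bimodule =
  algebra: assoc_algebra sB mult + module_space: vector_space sN
  for sB :: "'k::field \<Rightarrow> 'b::ab_group_add \<Rightarrow> 'b" and mult :: "'b \<Rightarrow> 'b \<Rightarrow> 'b"
    and sN :: "'k \<Rightarrow> 'n::ab_group_add \<Rightarrow> 'n" +
  fixes l :: "'b \<Rightarrow> 'n \<Rightarrow> 'n" and r :: "'n \<Rightarrow> 'b \<Rightarrow> 'n"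
  assumes left_bilinear: "bilinear_map sB sN sN l"
    and right_bilinear: "bilinear_map sN sB sN r"
    and left_assoc: "l (mult a b) u = l a (l b u)"
    and middle_assoc: "r (l a u) b = l a (r u b)"
    and right_assoc: "r (r u a) b = r u (mult a b)"

locale O_operator =
  bimodule sA mult sM l r
  for sA :: "'k::field \<Rightarrow> 'a::ab_group_add \<Rightarrow> 'a" and mult :: "'a \<Rightarrow> 'a \<Rightarrow> 'a"
    and sM :: "'k \<Rightarrow> 'm::ab_group_add \<Rightarrow> 'm"
    and l :: "'a \<Rightarrow> 'm \<Rightarrow> 'm" and r :: "'m \<Rightarrow> 'a \<Rightarrow> 'm" +
  fixes T :: "'m \<Rightarrow> 'a"
  assumes T_linear: "Vector_Spaces.linear sM sA T"
    and T_mult: "mult (T u) (T v) = T (l (T u) v + r u (T v))"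

locale compatible_O_operator =
  first: O_operator sA mult sM l r T1 + second: O_operator sA mult sM l r T2
  for sA :: "'k::field \<Rightarrow> 'a::ab_group_add \<Rightarrow> 'a" and mult :: "'a \<Rightarrow> 'a \<Rightarrow> 'a"
    and sM :: "'k \<Rightarrow> 'm::ab_group_add \<Rightarrow> 'm"
    and l :: "'a \<Rightarrow> 'm \<Rightarrow> 'm" and r :: "'m \<Rightarrow> 'a \<Rightarrow> 'm"
    and T1 :: "'m \<Rightarrow> 'a" and T2 :: "'m \<Rightarrow> 'a" +
  assumes compatible: "mult (T1 u) (T2 v) + mult (T2 u) (T1 v) =
      T1 (l (T2 u) v + r u (T2 v)) + T2 (l (T1 u) v + r u (T1 v))"

locale compatible_assoc_algebra =
  first: assoc_algebra sB m1 + second: assoc_algebra sB m2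
  for sB :: "'k::field \<Rightarrow> 'b::ab_group_add \<Rightarrow> 'b"
    and m1 :: "'b \<Rightarrow> 'b \<Rightarrow> 'b" and m2 :: "'b \<Rightarrow> 'b \<Rightarrow> 'b" +
  assumes compatible: "m2 (m1 a b) c + m1 (m2 a b) c = m2 a (m1 b c) + m1 a (m2 b c)"

locale compatible_bimodule =
  base: compatible_assoc_algebra sB m1 m2 +
  first: bimodule sB m1 sN l1 r1 + second: bimodule sB m2 sN l2 r2
  for sB :: "'k::field \<Rightarrow> 'b::ab_group_add \<Rightarrow> 'b"
    and m1 :: "'b \<Rightarrow> 'b \<Rightarrow> 'b" and m2 :: "'b \<Rightarrow> 'b \<Rightarrow> 'b"
    and sN :: "'k \<Rightarrow> 'n::ab_group_add \<Rightarrow> 'n"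
    and l1 :: "'b \<Rightarrow> 'n \<Rightarrow> 'n" and r1 :: "'n \<Rightarrow> 'b \<Rightarrow> 'n"
    and l2 :: "'b \<Rightarrow> 'n \<Rightarrow> 'n" and r2 :: "'n \<Rightarrow> 'b \<Rightarrow> 'n" +
  assumes compatible_left: "l2 (m1 a b) u + l1 (m2 a b) u = l1 a (l2 b u) + l2 a (l1 b u)"
    and compatible_middle: "r2 (l1 a u) b + r1 (l2 a u) b = l1 a (r2 u b) + l2 a (r1 u b)"
    and compatible_right: "r2 (r1 u a) b + r1 (r2 u a) b = r1 u (m2 a b) + r2 u (m1 a b)"

definition O_star ::
  "('a \<Rightarrow> 'm \<Rightarrow> 'm) \<Rightarrow> ('m \<Rightarrow> 'a \<Rightarrow> 'm) \<Rightarrow> ('m \<Rightarrow> 'a) \<Rightarrow> 'm \<Rightarrow> 'm \<Rightarrow> 'm::ab_group_add"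
  where "O_star l r T u v = l (T u) v + r u (T v)"

definition O_left ::
  "('a \<Rightarrow> 'a \<Rightarrow> 'a) \<Rightarrow> ('m \<Rightarrow> 'a \<Rightarrow> 'm) \<Rightarrow> ('m \<Rightarrow> 'a) \<Rightarrow> 'm \<Rightarrow> 'a \<Rightarrow> 'a::ab_group_add"
  where "O_left mult r T u a = mult (T u) a - T (r u a)"

definition O_right ::
  "('a \<Rightarrow> 'a \<Rightarrow> 'a) \<Rightarrow> ('a \<Rightarrow> 'm \<Rightarrow> 'm) \<Rightarrow> ('m \<Rightarrow> 'a) \<Rightarrow> 'a \<Rightarrow> 'm \<Rightarrow> 'a::ab_group_add"
  where "O_right mult l T a u = mult a (T u) - T (l a u)"

end

theory Submission
  imports Defs
begin

text \<open>
  The statement follows from its non-compatible version by polarization. The map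
  \<open>T \<mapsto> (star, left action, right action)\<close> is linear in \<open>T\<close>, whereas the axioms of an
  \<open>\<O>\<close>-operator, of an associative product and of a bimodule are quadratic. The mixed part of
  the quadratic \<open>\<O>\<close>-operator identity for \<open>T\<^sub>1 + T\<^sub>2\<close> is exactly the compatibility of
  \<open>(T\<^sub>1, T\<^sub>2)\<close>, so \<open>T\<^sub>1 + T\<^sub>2\<close> is again an \<open>\<O>\<close>-operator
  (\<open>compatible_O_operator.O_operator_sum\<close>). In the same way, two structures are compatible as
  soon as each of them and their sum satisfy the axioms
  (\<open>compatible_assoc_algebra_if_sum\<close>, \<open>compatible_bimodule_if_sum\<close>): expanding the axioms of
  the sum and cancelling those of the summands leaves the mixed terms.

  So all that is left is one computation for a single \<open>\<O>\<close>-operator \<open>T\<close>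
  (\<open>O_operator.O_star_assoc_algebra\<close>, \<open>O_operator.O_bimodule\<close>), which is then applied to
  \<open>T\<^sub>1\<close>, \<open>T\<^sub>2\<close> and \<open>T\<^sub>1 + T\<^sub>2\<close>.
\<close>

lemma linear_sum_maps:
  assumes "Vector_Spaces.linear sU sV f" and "Vector_Spaces.linear sU sV g"
  shows "Vector_Spaces.linear sU sV (\<lambda>x. f x + g x)"
    and "Vector_Spaces.linear sU sV (\<lambda>x. f x - g x)"
proof -
  interpret vector_space_pair sU sV
    using assms(1) by (simp add: Vector_Spaces.linear_iff vector_space_pair_def)
  show "Vector_Spaces.linear sU sV (\<lambda>x. f x + g x)"
    using assms by (rule linear_compose_add)
  show "Vector_Spaces.linear sU sV (\<lambda>x. f x - g x)"
    using assms by (rule linear_compose_sub)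
qed

lemma linear_comp:
  assumes "Vector_Spaces.linear sV sW g" and "Vector_Spaces.linear sU sV f"
  shows "Vector_Spaces.linear sU sW (\<lambda>x. g (f x))"
  using Vector_Spaces.linear_compose[OF assms(2,1)] by (simp add: comp_def)

lemma linear_add_diff:
  assumes "Vector_Spaces.linear sU sV f"
  shows "f (x + y) = f x + f y" and "f (x - y) = f x - f y"
  using Vector_Spaces.linear.axioms(3)[OF assms] module_hom.add module_hom.diff
    assms[unfolded Vector_Spaces.linear_def] by blast+

lemma bilinear_map_add_diff:
  assumes "bilinear_map sU sV sW f"
  shows "f (x + x') y = f x y + f x' y" and "f (x - x') y = f x y - f x' y"
    and "f x (y + y') = f x y + f x y'" and "f x (y - y') = f x y - f x y'"
  using assms linear_add_diff[of sU sW "\<lambda>x. f x y"] linear_add_diff[of sV sW "f x"]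
  by (auto simp: bilinear_map_def)

text \<open>
  The products and actions induced by an \<open>\<O>\<close>-operator \<open>T\<close> are sums and differences of the given
  bilinear maps with \<open>T\<close> inserted in an argument or applied to the value.
\<close>

lemma bilinear_map_sum:
  assumes "bilinear_map sU sV sW f" and "bilinear_map sU sV sW g"
  shows "bilinear_map sU sV sW (\<lambda>x y. f x y + g x y)"
    and "bilinear_map sU sV sW (\<lambda>x y. f x y - g x y)"
  using assms by (simp_all add: bilinear_map_def linear_sum_maps)

lemma bilinear_map_comp_left:
  assumes "bilinear_map sU sV sW f" and "Vector_Spaces.linear sX sU T"
  shows "bilinear_map sX sV sW (\<lambda>x y. f (T x) y)"
  using assms linear_comp[of sU sW "\<lambda>x. f x y" sX T for y]
  by (simp add: bilinear_map_def)

lemma bilinear_map_comp_right: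
  assumes "bilinear_map sU sV sW f" and "Vector_Spaces.linear sX sV T"
  shows "bilinear_map sU sX sW (\<lambda>x y. f x (T y))"
  using assms linear_comp[of sV sW "f x" sX T for x]
  by (simp add: bilinear_map_def)

lemma bilinear_map_comp_out:
  assumes "bilinear_map sU sV sW f" and "Vector_Spaces.linear sW sX T"
  shows "bilinear_map sU sV sX (\<lambda>x y. T (f x y))"
  using assms(1) by (simp add: bilinear_map_def linear_comp[OF assms(2)])

context O_operator
begin

lemmas T_add_diff = linear_add_diff[OF T_linear]
lemmas product_add_diff = bilinear_map_add_diff[OF algebra.mult_bilinear]
lemmas action_add_diff =
  bilinear_map_add_diff[OF left_bilinear] bilinear_map_add_diff[OF right_bilinear]

text \<open>
  The defining identity of an \<open>\<O>\<close>-operator says that \<open>T\<close> is multiplicative from the star product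
  to \<open>A\<close>. Hence both bracketings of \<open>u \<star> v \<star> w\<close> expand to
  \<open>T u \<cdot> T v \<cdot> w + T u \<cdot> v \<cdot> T w + u \<cdot> T v \<cdot> T w\<close>.
\<close>

lemma O_star_assoc_algebra: "assoc_algebra sM (O_star l r T)"
proof -
  have "O_star l r T (O_star l r T u v) w = O_star l r T u (O_star l r T v w)" for u v w
    by (simp add: O_star_def T_mult[symmetric] action_add_diff left_assoc middle_assoc
        right_assoc add.assoc)
  moreover have "bilinear_map sM sM sM (O_star l r T)"
    unfolding O_star_def
    by (intro bilinear_map_sum bilinear_map_comp_left[OF left_bilinear T_linear]
        bilinear_map_comp_right[OF right_bilinear T_linear])
  ultimately show ?thesis
    by unfold_locales
qed

text \<open>
  Besides terms that agree by the bimodule axioms and because \<open>T\<close> is multiplicative for the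
  star product, expanding leaves products of two values of
  \<open>T\<close>, one of which has an action inside: \<open>T u \<cdot> T (v \<cdot> a)\<close> for two left actions,
  \<open>T (a \<cdot> u) \<cdot> T v\<close> for two right ones, and one of each shape, on opposite sides, in the mixed
  axiom. The \<open>\<O>\<close>-operator identity splits \<open>T u \<cdot> T (v \<cdot> a)\<close> into
  \<open>T (T u \<cdot> (v \<cdot> a)) + T (u \<cdot> T (v \<cdot> a))\<close>. The summand with nested \<open>T (v \<cdot> a)\<close> cancels against
  the correction term of the outer action, and the other one matches a term of the opposite
  side. The second shape is symmetric.
\<close>

lemma O_bimodule: "bimodule sM (O_star l r T) sA (O_left mult r T) (O_right mult l T)"
proof -
  interpret star: assoc_algebra sM "O_star l r T"
    by (rule O_star_assoc_algebra)
  note expand = O_star_def O_left_def O_right_def product_add_diff action_add_diff T_add_diff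
    T_mult algebra.mult_assoc left_assoc middle_assoc right_assoc
  \<comment> \<open>The form of the identity that applies once products are associated to the right.\<close>
  have T_mult': "mult (T u) (mult (T v) a) = mult (T (l (T u) v)) a + mult (T (r u (T v))) a"
    for u v a
    by (metis T_mult T_add_diff(1) algebra.mult_assoc product_add_diff(1))
  show ?thesis
  proof
    show "bilinear_map sM sA sA (O_left mult r T)"
      unfolding O_left_def
      by (intro bilinear_map_sum bilinear_map_comp_left[OF algebra.mult_bilinear T_linear]
          bilinear_map_comp_out[OF right_bilinear T_linear])
    show "bilinear_map sA sM sA (O_right mult l T)"
      unfolding O_right_def
      by (intro bilinear_map_sum bilinear_map_comp_right[OF algebra.mult_bilinear T_linear]
          bilinear_map_comp_out[OF left_bilinear T_linear])
    fix u v a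
    show "O_left mult r T (O_star l r T u v) a = O_left mult r T u (O_left mult r T v a)"
      by (simp add: expand T_mult')
    show "O_right mult l T (O_left mult r T u a) v = O_left mult r T u (O_right mult l T a v)"
      by (simp add: expand)
    show "O_right mult l T (O_right mult l T a u) v = O_right mult l T a (O_star l r T u v)"
      by (simp add: expand)
  qed
qed

end

lemma (in compatible_O_operator) O_operator_sum:
  "O_operator sA mult sM l r (\<lambda>u. T1 u + T2 u)"
proof (intro O_operator.intro O_operator_axioms.intro)
  show "bimodule sA mult sM l r"
    by (rule first.bimodule_axioms)
  show "Vector_Spaces.linear sM sA (\<lambda>u. T1 u + T2 u)"
    by (rule linear_sum_maps[OF first.T_linear second.T_linear])
  show "mult (T1 u + T2 u) (T1 v + T2 v) =
      T1 (l (T1 u + T2 u) v + r u (T1 v + T2 v)) + T2 (l (T1 u + T2 u) v + r u (T1 v + T2 v))"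
    for u v
    using first.T_mult[of u v] second.T_mult[of u v] compatible[of u v]
    by (simp add: first.product_add_diff first.action_add_diff first.T_add_diff
        second.T_add_diff algebra_simps)
qed

lemma compatible_assoc_algebra_if_sum:
  assumes "assoc_algebra sB m1" and "assoc_algebra sB m2"
    and "assoc_algebra sB (\<lambda>a b. m1 a b + m2 a b)"
  shows "compatible_assoc_algebra sB m1 m2"
proof -
  interpret first: assoc_algebra sB m1 by fact
  interpret second: assoc_algebra sB m2 by fact
  interpret total: assoc_algebra sB "\<lambda>a b. m1 a b + m2 a b" by fact
  show ?thesis
  proof
    show "m2 (m1 a b) c + m1 (m2 a b) c = m2 a (m1 b c) + m1 a (m2 b c)" for a b c
      using total.mult_assoc[of a b c]
      by (simp add: bilinear_map_add_diff[OF first.mult_bilinear]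
          bilinear_map_add_diff[OF second.mult_bilinear] first.mult_assoc second.mult_assoc
          algebra_simps)
  qed
qed

lemma compatible_bimodule_if_sum:
  assumes "compatible_assoc_algebra sB m1 m2"
    and "bimodule sB m1 sN l1 r1" and "bimodule sB m2 sN l2 r2"
    and "bimodule sB (\<lambda>a b. m1 a b + m2 a b) sN
      (\<lambda>a u. l1 a u + l2 a u) (\<lambda>u a. r1 u a + r2 u a)"
  shows "compatible_bimodule sB m1 m2 sN l1 r1 l2 r2"
proof -
  interpret base: compatible_assoc_algebra sB m1 m2 by fact
  interpret first: bimodule sB m1 sN l1 r1 by fact
  interpret second: bimodule sB m2 sN l2 r2 by fact
  interpret total: bimodule sB "\<lambda>a b. m1 a b + m2 a b" sN
    "\<lambda>a u. l1 a u + l2 a u" "\<lambda>u a. r1 u a + r2 u a" by fact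
  note expand = bilinear_map_add_diff[OF first.left_bilinear]
    bilinear_map_add_diff[OF second.left_bilinear]
    bilinear_map_add_diff[OF first.right_bilinear]
    bilinear_map_add_diff[OF second.right_bilinear]
  show ?thesis
  proof
    fix a b u
    show "l2 (m1 a b) u + l1 (m2 a b) u = l1 a (l2 b u) + l2 a (l1 b u)"
      using total.left_assoc[of a b u]
      by (simp add: expand first.left_assoc second.left_assoc algebra_simps)
    show "r2 (l1 a u) b + r1 (l2 a u) b = l1 a (r2 u b) + l2 a (r1 u b)"
      using total.middle_assoc[of a u b]
      by (simp add: expand first.middle_assoc second.middle_assoc algebra_simps)
    show "r2 (r1 u a) b + r1 (r2 u a) b = r1 u (m2 a b) + r2 u (m1 a b)"
      using total.right_assoc[of u a b]
      by (simp add: expand first.right_assoc second.right_assoc algebra_simps)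
  qed
qed

theorem theorem2p6:
  fixes sA :: "'k::field_char_0 \<Rightarrow> 'a::ab_group_add \<Rightarrow> 'a"
    and mult :: "'a \<Rightarrow> 'a \<Rightarrow> 'a"
    and sM :: "'k \<Rightarrow> 'm::ab_group_add \<Rightarrow> 'm"
    and l :: "'a \<Rightarrow> 'm \<Rightarrow> 'm" and r :: "'m \<Rightarrow> 'a \<Rightarrow> 'm"
    and T1 T2 :: "'m \<Rightarrow> 'a"
  assumes "assoc_algebra sA mult"
    and "bimodule sA mult sM l r"
    and "compatible_O_operator sA mult sM l r T1 T2"
  shows "compatible_assoc_algebra sM (O_star l r T1) (O_star l r T2) \<and>
    compatible_bimodule sM (O_star l r T1) (O_star l r T2) sA
      (O_left mult r T1) (O_right mult l T1) (O_left mult r T2) (O_right mult l T2)"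
proof -
  interpret compatible_O_operator sA mult sM l r T1 T2 by fact
  let ?T = "\<lambda>u. T1 u + T2 u"
  interpret total: O_operator sA mult sM l r ?T by (rule O_operator_sum)
  have star: "O_star l r ?T = (\<lambda>u v. O_star l r T1 u v + O_star l r T2 u v)"
    by (intro ext) (simp add: O_star_def first.action_add_diff algebra_simps)
  have left: "O_left mult r ?T = (\<lambda>u a. O_left mult r T1 u a + O_left mult r T2 u a)"
    by (intro ext) (simp add: O_left_def first.product_add_diff algebra_simps)
  have right: "O_right mult l ?T = (\<lambda>a u. O_right mult l T1 a u + O_right mult l T2 a u)"
    by (intro ext) (simp add: O_right_def first.product_add_diff algebra_simps)
  have algebra: "compatible_assoc_algebra sM (O_star l r T1) (O_star l r T2)"
    using first.O_star_assoc_algebra second.O_star_assoc_algebra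
      total.O_star_assoc_algebra[unfolded star]
    by (rule compatible_assoc_algebra_if_sum)
  moreover have "compatible_bimodule sM (O_star l r T1) (O_star l r T2) sA
      (O_left mult r T1) (O_right mult l T1) (O_left mult r T2) (O_right mult l T2)"
    using algebra first.O_bimodule second.O_bimodule total.O_bimodule[unfolded star left right]
    by (rule compatible_bimodule_if_sum)
  ultimately show ?thesis ..
qed

end
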